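(* Let $(M,g)$ be a (pseudo-)Riemannian manifold whose metric is factorized as $g_{ab}=\sum_{I=1}^{n}A_{Ia}A_{Ib}$ by a set of pointwise linearly independent complex-valued $1$-forms $\mathbf{A}_1,\dots,\mathbf{A}_n$ on $M$. If every $\mathbf{A}_I$ is closed, $d\mathbf{A}_I=0$, then the manifold is non-curved: its Riemann curvature tensor vanishes, $R_{abcd}=0$.
   Context: $M$ is an $n$-dimensional compact, differentiable, oriented and connected manifold with a metric $g$ locally reducible at each point to $\mathrm{diag}(1,\dots,1,-1,\dots,-1)$ ($r$ plus signs and $s=n-r$ minus signs; $s=0$ is the positive definite case). The metric is written, by a Takagi factorization, as $g_{ab}=\sum_{I=1}^n A_{Ia}A_{Ib}$, where $\mathbf{A}_I=A_{Ia}\,\mathbf{w}^a$ ($I=1,\dots,n$) are smooth $1$-forms on $M$, possibly complex-valued, linearly independent at each point; $\mathbf{w}^a$ is the dual of the basis of the tangent space. The index $I$ enumerates the forms and is not a tensor index; lower-case indices are tensor component indices. $R_{abcd}$ is the curvature tensor of the Levi-Civita connection of $g$. *)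

theory Defs
  imports "HOL-Analysis.Analysis"
begin

section \<open>Smooth maps between normed spaces\<close>

text \<open>Meant for open \<open>S\<close>.\<close>

primrec Ck_on :: "nat \<Rightarrow> 'a::real_normed_vector set \<Rightarrow> ('a \<Rightarrow> 'b::real_normed_vector) \<Rightarrow> bool" where
  "Ck_on 0 S f \<longleftrightarrow> continuous_on S f"
| "Ck_on (Suc k) S f \<longleftrightarrow>
     (\<forall>x\<in>S. f differentiable at x) \<and> (\<forall>v. Ck_on k S (\<lambda>x. frechet_derivative f (at x) v))"

definition smooth_on :: "'a::real_normed_vector set \<Rightarrow> ('a \<Rightarrow> 'b::real_normed_vector) \<Rightarrow> bool" where
  "smooth_on S f \<longleftrightarrow> (\<forall>k. Ck_on k S f)"


section \<open>Manifolds\<close>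

text \<open>
  A chart is a domain together with a coordinate map; the values of the map outside the domain
  are irrelevant. The dimension of the manifold is \<open>CARD('n)\<close>.
\<close>

type_synonym ('a, 'n) chart = "'a set \<times> ('a \<Rightarrow> real ^ 'n)"

definition is_chart :: "'a topology \<Rightarrow> ('a, 'n::finite) chart \<Rightarrow> bool" where
  "is_chart M c \<longleftrightarrow> openin M (fst c) \<and> open (snd c ` fst c) \<and>
     homeomorphic_map (subtopology M (fst c)) (top_of_set (snd c ` fst c)) (snd c)"

definition in_coords :: "('a, 'n::finite) chart \<Rightarrow> ('a \<Rightarrow> 'b) \<Rightarrow> real ^ 'n \<Rightarrow> 'b" where
  "in_coords c f = f \<circ> inv_into (fst c) (snd c)"

text \<open>\<open>chart_deriv c a f p\<close> is the partial derivative \<open>\<partial>f / \<partial>x\<^sup>a\<close> at the point \<open>p\<close>, with respect to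
  the coordinates \<open>x\<close> of the chart \<open>c\<close>.\<close>

definition chart_deriv ::
  "('a, 'n::finite) chart \<Rightarrow> 'n \<Rightarrow> ('a \<Rightarrow> 'b::real_normed_vector) \<Rightarrow> 'a \<Rightarrow> 'b" where
  "chart_deriv c a f p = frechet_derivative (in_coords c f) (at (snd c p)) (axis a 1)"

text \<open>The Jacobian matrix \<open>\<partial>y\<^sup>a / \<partial>x\<^sup>b\<close> (row \<open>a\<close>, column \<open>b\<close>), where \<open>x\<close> and \<open>y\<close> are the coordinates of
  \<open>c\<close> and \<open>d\<close>.\<close>

definition transition_jacobian :: "('a, 'n::finite) chart \<Rightarrow> ('a, 'n) chart \<Rightarrow> 'a \<Rightarrow> real ^ 'n ^ 'n" where
  "transition_jacobian c d p = (\<chi> a b. chart_deriv c b (\<lambda>q. snd d q $ a) p)"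

text \<open>The atlas need not be maximal.\<close>

definition smooth_atlas :: "'a topology \<Rightarrow> ('a, 'n::finite) chart set \<Rightarrow> bool" where
  "smooth_atlas M \<A> \<longleftrightarrow> (\<forall>c\<in>\<A>. is_chart M c) \<and> (\<Union>c\<in>\<A>. fst c) = topspace M \<and>
     (\<forall>c\<in>\<A>. \<forall>d\<in>\<A>. smooth_on (snd c ` (fst c \<inter> fst d)) (in_coords c (snd d)))"

definition oriented_atlas :: "('a, 'n::finite) chart set \<Rightarrow> bool" where
  "oriented_atlas \<A> \<longleftrightarrow> (\<forall>c\<in>\<A>. \<forall>d\<in>\<A>. \<forall>p \<in> fst c \<inter> fst d. det (transition_jacobian c d p) > 0)"

text \<open>Second countability is automatic for a compact, locally Euclidean space.\<close>

definition compact_oriented_connected_manifold ::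
  "'a topology \<Rightarrow> ('a, 'n::finite) chart set \<Rightarrow> bool" where
  "compact_oriented_connected_manifold M \<A> \<longleftrightarrow>
     Hausdorff_space M \<and> compact_space M \<and> connected_space M \<and> topspace M \<noteq> {} \<and>
     smooth_atlas M \<A> \<and> oriented_atlas \<A>"


section \<open>Tensor fields\<close>

text \<open>
  A tensor field is given by its components in each chart of the atlas (with respect to the
  coordinate basis), as functions on the chart domain related by the tensor transformation law.
\<close>

type_synonym ('a, 'n, 'b) field = "('a, 'n) chart \<Rightarrow> 'a \<Rightarrow> 'b"

definition complex_one_form ::
  "('a, 'n::finite) chart set \<Rightarrow> ('a, 'n, complex ^ 'n) field \<Rightarrow> bool" where
  "complex_one_form \<A> \<omega> \<longleftrightarrow>
     (\<forall>c\<in>\<A>. smooth_on (snd c ` fst c) (in_coords c (\<omega> c))) \<and>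
     (\<forall>c\<in>\<A>. \<forall>d\<in>\<A>. \<forall>p \<in> fst c \<inter> fst d. \<forall>a.
        \<omega> c p $ a = (\<Sum>b\<in>UNIV. of_real (transition_jacobian c d p $ b $ a) * \<omega> d p $ b))"

text \<open>The components \<open>(d\<omega>)\<^sub>a\<^sub>b = \<partial>\<^sub>a \<omega>\<^sub>b - \<partial>\<^sub>b \<omega>\<^sub>a\<close> of the exterior derivative of a one-form.\<close>

definition ext_deriv ::
  "('a, 'n::finite, complex ^ 'n) field \<Rightarrow> ('a, 'n, complex ^ 'n ^ 'n) field" where
  "ext_deriv \<omega> c p =
     (\<chi> a b. chart_deriv c a (\<lambda>q. \<omega> c q $ b) p - chart_deriv c b (\<lambda>q. \<omega> c q $ a) p)"

definition closed_one_form ::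
  "('a, 'n::finite) chart set \<Rightarrow> ('a, 'n, complex ^ 'n) field \<Rightarrow> bool" where
  "closed_one_form \<A> \<omega> \<longleftrightarrow> (\<forall>c\<in>\<A>. \<forall>p\<in>fst c. ext_deriv \<omega> c p = 0)"

text \<open>Linear independence over the complex numbers of a family of one-forms, at each point.\<close>

definition pointwise_independent ::
  "('a, 'n::finite) chart set \<Rightarrow> ('i::finite \<Rightarrow> ('a, 'n, complex ^ 'n) field) \<Rightarrow> bool" where
  "pointwise_independent \<A> A \<longleftrightarrow>
     (\<forall>c\<in>\<A>. \<forall>p\<in>fst c. \<forall>k :: 'i \<Rightarrow> complex.
        (\<Sum>I\<in>UNIV. k I *s A I c p) = 0 \<longrightarrow> (\<forall>I. k I = 0))"

definition sign_diag :: "'n::finite set \<Rightarrow> real ^ 'n ^ 'n" where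
  "sign_diag S = (\<chi> i j. if i = j then (if i \<in> S then 1 else - 1) else 0)"

text \<open>Metrics with \<open>r\<close> plus signs and \<open>CARD('n) - r\<close> minus signs; the columns of \<open>P\<close> form a basis
  of the tangent space in which the metric is diagonal.\<close>

definition pseudo_riemannian_metric ::
  "('a, 'n::finite) chart set \<Rightarrow> nat \<Rightarrow> ('a, 'n, real ^ 'n ^ 'n) field \<Rightarrow> bool" where
  "pseudo_riemannian_metric \<A> r g \<longleftrightarrow>
     (\<forall>c\<in>\<A>. smooth_on (snd c ` fst c) (in_coords c (g c))) \<and>
     (\<forall>c\<in>\<A>. \<forall>d\<in>\<A>. \<forall>p \<in> fst c \<inter> fst d.
        g c p = transpose (transition_jacobian c d p) ** g d p ** transition_jacobian c d p) \<and>
     (\<forall>c\<in>\<A>. \<forall>p\<in>fst c. transpose (g c p) = g c p \<and>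
        (\<exists>(P :: real ^ 'n ^ 'n) S. invertible P \<and> card S = r \<and> transpose P ** g c p ** P = sign_diag S))"


section \<open>The Levi-Civita connection and its curvature\<close>

text \<open>\<open>christoffel g c p a b e\<close> is \<open>\<Gamma>\<^sup>a\<^sub>b\<^sub>e = 1/2 g\<^sup>a\<^sup>f (\<partial>\<^sub>b g\<^sub>f\<^sub>e + \<partial>\<^sub>e g\<^sub>f\<^sub>b - \<partial>\<^sub>f g\<^sub>b\<^sub>e)\<close>.\<close>

definition christoffel ::
  "('a, 'n::finite, real ^ 'n ^ 'n) field \<Rightarrow> ('a, 'n, 'n \<Rightarrow> 'n \<Rightarrow> 'n \<Rightarrow> real) field" where
  "christoffel g c p a b e =
     (\<Sum>f\<in>UNIV. matrix_inv (g c p) $ a $ f *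
        (chart_deriv c b (\<lambda>q. g c q $ f $ e) p + chart_deriv c e (\<lambda>q. g c q $ f $ b) p
         - chart_deriv c f (\<lambda>q. g c q $ b $ e) p)) / 2"

text \<open>\<open>riemann_up g c p a b e f\<close> is
  \<open>R\<^sup>a\<^sub>b\<^sub>e\<^sub>f = \<partial>\<^sub>e \<Gamma>\<^sup>a\<^sub>f\<^sub>b - \<partial>\<^sub>f \<Gamma>\<^sup>a\<^sub>e\<^sub>b + \<Gamma>\<^sup>a\<^sub>e\<^sub>h \<Gamma>\<^sup>h\<^sub>f\<^sub>b - \<Gamma>\<^sup>a\<^sub>f\<^sub>h \<Gamma>\<^sup>h\<^sub>e\<^sub>b\<close>.\<close>

definition riemann_up ::
  "('a, 'n::finite, real ^ 'n ^ 'n) field \<Rightarrow> ('a, 'n, 'n \<Rightarrow> 'n \<Rightarrow> 'n \<Rightarrow> 'n \<Rightarrow> real) field" where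
  "riemann_up g c p a b e f =
     chart_deriv c e (\<lambda>q. christoffel g c q a f b) p
     - chart_deriv c f (\<lambda>q. christoffel g c q a e b) p
     + (\<Sum>h\<in>UNIV. christoffel g c p a e h * christoffel g c p h f b
                 - christoffel g c p a f h * christoffel g c p h e b)"

text \<open>All indices lowered: \<open>R\<^sub>a\<^sub>b\<^sub>e\<^sub>f = g\<^sub>a\<^sub>h R\<^sup>h\<^sub>b\<^sub>e\<^sub>f\<close>.\<close>

definition riemann ::
  "('a, 'n::finite, real ^ 'n ^ 'n) field \<Rightarrow> ('a, 'n, 'n \<Rightarrow> 'n \<Rightarrow> 'n \<Rightarrow> 'n \<Rightarrow> real) field" where
  "riemann g c p a b e f = (\<Sum>h\<in>UNIV. g c p $ a $ h * riemann_up g c p h b e f)"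

lemma in_coords_chart:
  assumes "is_chart M c" "q \<in> fst c"
  shows "in_coords c f (snd c q) = f q"
proof -
  have "inj_on (snd c) (topspace (subtopology M (fst c)))"
    using assms(1) unfolding is_chart_def homeomorphic_map_def by blast
  moreover have "topspace (subtopology M (fst c)) = fst c"
    using assms(1) openin_subset[of M "fst c"] unfolding is_chart_def by auto
  ultimately show ?thesis using assms(2) by (simp add: in_coords_def)
qed

lemma chart_deriv_cong:
  assumes c: "is_chart M c" "p \<in> fst c" and eq: "\<And>q. q \<in> fst c \<Longrightarrow> f q = h q"
  shows "chart_deriv c a f p = chart_deriv c a h p"
proof -
  have e: "in_coords c f x = in_coords c h x" if "x \<in> snd c ` fst c" for x
    using that c eq by (auto simp: in_coords_chart)
  have o: "open (snd c ` fst c)" "snd c p \<in> snd c ` fst c" using c by (auto simp: is_chart_def)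
  have "(in_coords c f has_derivative D) (at (snd c p)) \<longleftrightarrow>
        (in_coords c h has_derivative D) (at (snd c p))" for D
    using has_derivative_transform_within_open[of "in_coords c f" D "snd c p" UNIV "snd c ` fst c" "in_coords c h"]
      has_derivative_transform_within_open[of "in_coords c h" D "snd c p" UNIV "snd c ` fst c" "in_coords c f"]
      o e by auto
  then show ?thesis by (simp add: chart_deriv_def frechet_derivative_def)
qed

lemma metric_invertible:
  fixes g :: "('a, 'n::finite, real ^ 'n ^ 'n) field"
  assumes "pseudo_riemannian_metric \<A> r g" "c \<in> \<A>" "p \<in> fst c"
  shows "invertible (g c p)"
proof -
  obtain P :: "real ^ 'n ^ 'n" and S where P: "transpose P ** g c p ** P = sign_diag S"
    using assms unfolding pseudo_riemannian_metric_def by meson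
  have "det (sign_diag S) \<noteq> 0"
    by (subst det_diagonal) (auto simp: sign_diag_def)
  then show ?thesis
    by (metis P det_mul invertible_det_nz mult_eq_0_iff)
qed

text \<open>The Christoffel symbols are the coefficients of the Levi-Civita connection: they are the only
  torsion-free coefficients that are compatible with the metric.\<close>

lemma christoffel_levi_civita:
  assumes g: "pseudo_riemannian_metric \<A> r g" and c: "is_chart M c" "c \<in> \<A>" "p \<in> fst c"
  shows "(\<forall>a b e. \<Gamma> a b e = \<Gamma> a e b) \<and>
     (\<forall>a b e. chart_deriv c e (\<lambda>q. g c q $ a $ b) p =
        (\<Sum>h\<in>UNIV. \<Gamma> h e a * g c p $ h $ b + \<Gamma> h e b * g c p $ a $ h))
     \<longleftrightarrow> \<Gamma> = christoffel g c p" (is "?L \<longleftrightarrow> ?R")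
proof -
  have gs0: "g c q $ a $ b = g c q $ b $ a" if "q \<in> fst c" for q a b
    using g c(2) that unfolding pseudo_riemannian_metric_def
    by (metis (no_types, lifting) transpose_def vec_lambda_beta)
  note gs = gs0[OF c(3)]
  have inv: "g c p ** matrix_inv (g c p) = mat 1" "matrix_inv (g c p) ** g c p = mat 1"
    using metric_invertible[OF g c(2,3)] by (auto simp: matrix_inv_def invertible_def intro: someI2_ex)
  define D where "D e a b = chart_deriv c e (\<lambda>q. g c q $ a $ b) p" for e a b
  have Ds: "D e a b = D e b a" for e a b
    unfolding D_def by (rule chart_deriv_cong[OF c(1,3)]) (simp add: gs0)
  define K where "K f b e = (D b f e + D e f b - D f b e) / 2" for f b e
  have ch: "christoffel g c p a b e = (\<Sum>f\<in>UNIV. matrix_inv (g c p) $ a $ f * K f b e)" for a b e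
    by (simp add: christoffel_def D_def K_def sum_divide_distrib)
  have low: "\<Gamma> = christoffel g c p \<longleftrightarrow> (\<forall>f b e. (\<Sum>h\<in>UNIV. g c p $ f $ h * \<Gamma> h b e) = K f b e)"
  proof -
    have *: "(\<Sum>h\<in>UNIV. X $ f $ h * (\<Sum>k\<in>UNIV. Y $ h $ k * u k)) = u f"
      if "X ** Y = mat 1" for X Y :: "real^'b^'b" and u f
    proof -
      have "X *v (Y *v (\<chi> k. u k)) = (\<chi> k. u k)"
        using that by (simp add: matrix_vector_mul_assoc)
      then have "(X *v (Y *v (\<chi> k. u k))) $ f = u f" by simp
      then show ?thesis by (simp add: matrix_vector_mult_def)
    qed
    show ?thesis
    proof
      assume "\<Gamma> = christoffel g c p"
      then show "\<forall>f b e. (\<Sum>h\<in>UNIV. g c p $ f $ h * \<Gamma> h b e) = K f b e"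
        using *[OF inv(1)] by (simp add: ch)
    next
      assume r: "\<forall>f b e. (\<Sum>h\<in>UNIV. g c p $ f $ h * \<Gamma> h b e) = K f b e"
      have "christoffel g c p a b e = \<Gamma> a b e" for a b e
        unfolding ch using *[OF inv(2), of a "\<lambda>h. \<Gamma> h b e"] r by simp
      then show "\<Gamma> = christoffel g c p" by (intro ext) simp
    qed
  qed
  define G where "G f b e = (\<Sum>h\<in>UNIV. g c p $ f $ h * \<Gamma> h b e)" for f b e
  have L2: "(\<Sum>h\<in>UNIV. \<Gamma> h e a * g c p $ h $ b + \<Gamma> h e b * g c p $ a $ h) = G b e a + G a e b" for a b e
  proof -
    have "(\<Sum>h\<in>UNIV. \<Gamma> h e a * g c p $ h $ b) = G b e a"
      unfolding G_def by (rule sum.cong[OF refl]) (metis gs mult.commute)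
    moreover have "(\<Sum>h\<in>UNIV. \<Gamma> h e b * g c p $ a $ h) = G a e b"
      unfolding G_def by (rule sum.cong[OF refl]) (rule mult.commute)
    ultimately show ?thesis by (simp add: sum.distrib)
  qed
  show ?thesis
  proof
    assume L: ?L
    have Gs: "G f b e = G f e b" for f b e
      unfolding G_def
    proof (rule sum.cong[OF refl])
      fix h show "g c p $ f $ h * \<Gamma> h b e = g c p $ f $ h * \<Gamma> h e b"
        by (rule arg_cong[where f = "\<lambda>z. g c p $ f $ h * z"]) (use L in blast)
    qed
    have "D e a b = G b e a + G a e b" for a b e
      using L by (simp add: D_def L2)
    then have "G f b e = K f b e" for f b e
      unfolding K_def using Gs[of e b f] Gs[of b e f] Gs[of f b e] by simp
    then show ?R by (simp add: low G_def)
  next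
    assume R: ?R
    then have GK: "G f b e = K f b e" for f b e by (simp add: low G_def)
    have Ks: "K f b e = K f e b" for f b e using Ds[of f b e] by (simp add: K_def)
    have "christoffel g c p a b e = christoffel g c p a e b" for a b e
      unfolding ch by (rule sum.cong[OF refl], subst Ks, rule refl)
    moreover have "D e a b = G b e a + G a e b" for a b e
      unfolding GK K_def using Ds[of e a b] Ds[of a b e] Ds[of b e a] by (simp add: field_simps)
    ultimately show ?L unfolding L2 using R by (simp add: D_def)
  qed
qed

end

theory Submission
  imports Defs
begin

text \<open>
  Write \<open>\<nabla>\<close> for the Levi-Civita connection and \<open>\<Gamma>\<close> for its Christoffel symbols in a chart. The
  point is that a closed coframe in which the metric has constant components is parallel, and that
  curvature is the obstruction to the existence of enough parallel forms.

  Put \<open>X\<^sub>I\<^sub>b\<^sub>e = (\<nabla>\<^sub>b A\<^sub>I)\<^sub>e = \<partial>\<^sub>b A\<^sub>I\<^sub>e - A\<^sub>I\<^sub>h \<Gamma>\<^sup>h\<^sub>b\<^sub>e\<close> and \<open>Y\<^sub>f\<^sub>b\<^sub>e = \<Sum>\<^sub>I A\<^sub>I\<^sub>f X\<^sub>I\<^sub>b\<^sub>e\<close>. Closedness of the forms and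
  vanishing torsion make \<open>Y\<close> symmetric in its last two indices. Differentiating
  \<open>g = \<Sum>\<^sub>I A\<^sub>I A\<^sub>I\<close> covariantly and using \<open>\<nabla>g = 0\<close> makes it antisymmetric in the first and the third.
  A tensor with both symmetries is zero, and pointwise independence turns \<open>Y = 0\<close> into
  \<open>X\<^sub>I = 0\<close> for each \<open>I\<close>; this is \<open>closed_coframe_parallel\<close>.

  If \<open>\<nabla>\<omega> = 0\<close>, then \<open>\<partial>\<^sub>f \<omega>\<^sub>b = \<omega>\<^sub>h \<Gamma>\<^sup>h\<^sub>f\<^sub>b\<close> near the point, and differentiating once more expresses the
  commutator of \<open>\<partial>\<^sub>e\<close> and \<open>\<partial>\<^sub>f\<close> on \<open>\<omega>\<^sub>b\<close> as \<open>\<omega>\<^sub>h R\<^sup>h\<^sub>b\<^sub>e\<^sub>f\<close>. The commutator vanishes, so every parallel form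
  annihilates the curvature (\<open>parallel_form_annihilates_curvature\<close>). Finally
  \<open>R\<^sub>a\<^sub>b\<^sub>e\<^sub>f = g\<^sub>a\<^sub>h R\<^sup>h\<^sub>b\<^sub>e\<^sub>f = \<Sum>\<^sub>I A\<^sub>I\<^sub>a (A\<^sub>I\<^sub>h R\<^sup>h\<^sub>b\<^sub>e\<^sub>f) = 0\<close>.

  Two analytic facts enter: partial derivatives commute (\<open>second_derivative_symmetric\<close>), and the
  Christoffel symbols are differentiable because, by Cramer's rule, the inverse metric is a rational
  function of the metric.
\<close>

section \<open>Symmetry of second derivatives\<close>

lemma frechet_derivative_bounded_linear:
  assumes "bounded_linear h" "f differentiable at x"
  shows "frechet_derivative (\<lambda>y. h (f y)) (at x) v = h (frechet_derivative f (at x) v)"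
    and "(\<lambda>y. h (f y)) differentiable at x"
proof -
  have "((\<lambda>y. h (f y)) has_derivative (\<lambda>v. h (frechet_derivative f (at x) v))) (at x)"
    using bounded_linear.has_derivative[OF assms(1)] assms(2) frechet_derivative_works by blast
  from frechet_derivative_at[OF this, symmetric] differentiableI[OF this]
  show "frechet_derivative (\<lambda>y. h (f y)) (at x) v = h (frechet_derivative f (at x) v)"
    and "(\<lambda>y. h (f y)) differentiable at x" by simp_all
qed

lemma differentiable_cong_open:
  assumes "open S" "x \<in> S" "\<And>y. y \<in> S \<Longrightarrow> f y = g y" "f differentiable at x"
  shows "g differentiable at x"
proof -
  from assms(4) obtain D where "(f has_derivative D) (at x)" by (auto simp: differentiable_def)
  from has_derivative_transform_within_open[OF this assms(1-3)] show ?thesis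
    by (rule differentiableI)
qed

lemma Ck_on_cong:
  assumes "open S" "\<And>y. y \<in> S \<Longrightarrow> f y = g y" "Ck_on k S f"
  shows "Ck_on k S g"
  using assms(2,3)
proof (induction k arbitrary: f g)
  case 0
  then show ?case using continuous_on_eq[of S f g] by simp
next
  case (Suc k)
  have d: "g differentiable at x" if "x \<in> S" for x
    using differentiable_cong_open[OF assms(1) that, of f g] Suc.prems that by simp
  have "frechet_derivative f (at x) = frechet_derivative g (at x)" if "x \<in> S" for x
    using frechet_derivative_transform_within_open[of f x S g] Suc.prems assms(1) that by simp
  then have "Ck_on k S (\<lambda>x. frechet_derivative g (at x) v)" for v
    using Suc.IH[of "\<lambda>x. frechet_derivative f (at x) v" "\<lambda>x. frechet_derivative g (at x) v"]
      Suc.prems(2) by simp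
  with d show ?case by simp
qed

lemma Ck_on_bounded_linear:
  assumes "open S" "bounded_linear h" "Ck_on k S f"
  shows "Ck_on k S (\<lambda>x. h (f x))"
  using assms(3)
proof (induction k arbitrary: f)
  case 0
  then show ?case by (simp add: bounded_linear.continuous_on[OF assms(2)])
next
  case (Suc k)
  have "Ck_on k S (\<lambda>x. frechet_derivative (\<lambda>y. h (f y)) (at x) v)" for v
  proof (rule Ck_on_cong[OF assms(1)])
    show "Ck_on k S (\<lambda>x. h (frechet_derivative f (at x) v))"
      using Suc.IH[of "\<lambda>x. frechet_derivative f (at x) v"] Suc.prems by simp
    show "h (frechet_derivative f (at y) v) = frechet_derivative (\<lambda>y. h (f y)) (at y) v"
      if "y \<in> S" for y
      using Suc.prems that frechet_derivative_bounded_linear(1)[OF assms(2), of f y v] by simp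
  qed
  then show ?case
    using Suc.prems frechet_derivative_bounded_linear(2)[OF assms(2), of f] by simp
qed

lemma smooth_on_bounded_linear:
  assumes "open S" "bounded_linear h" "smooth_on S f"
  shows "smooth_on S (\<lambda>x. h (f x))"
  using Ck_on_bounded_linear[OF assms(1,2)] assms(3) by (simp add: smooth_on_def)

lemma smooth_on_differentiable:
  assumes "smooth_on S f" "x \<in> S"
  shows "f differentiable at x"
proof -
  have "Ck_on (Suc 0) S f" using assms(1) unfolding smooth_on_def by (rule spec)
  then show ?thesis using assms(2) by simp
qed

lemma smooth_on_frechet_derivative:
  assumes "smooth_on S f"
  shows "smooth_on S (\<lambda>x. frechet_derivative f (at x) v)"
  unfolding smooth_on_def
proof
  fix k
  have "Ck_on (Suc k) S f" using assms unfolding smooth_on_def by (rule spec)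
  then show "Ck_on k S (\<lambda>x. frechet_derivative f (at x) v)" by simp
qed

lemma has_real_derivative_along_line:
  fixes f :: "'a::real_normed_vector \<Rightarrow> real"
  assumes "f differentiable at (y + s *\<^sub>R u)"
  shows "((\<lambda>s. f (y + s *\<^sub>R u)) has_real_derivative frechet_derivative f (at (y + s *\<^sub>R u)) u) (at s)"
proof -
  have "(f has_derivative frechet_derivative f (at (y + s *\<^sub>R u))) (at (y + s *\<^sub>R u))"
    using assms frechet_derivative_works by blast
  moreover have "((\<lambda>s. y + s *\<^sub>R u) has_vector_derivative u) (at s)"
    by (auto intro!: derivative_eq_intros)
  ultimately show ?thesis
    using vector_derivative_diff_chain_within[of "\<lambda>s. y + s *\<^sub>R u" u s UNIV f]
    by (simp add: o_def has_real_derivative_iff_has_vector_derivative has_derivative_at_withinI)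
qed

text \<open>
  The mean value theorem, applied first along \<open>u\<close> to the increment of \<open>f\<close> in the direction \<open>v\<close> and
  then along \<open>v\<close>. The left-hand side is symmetric in \<open>u\<close> and \<open>v\<close> while the right-hand side is a
  mixed derivative taken in a definite order; this yields the symmetry of second derivatives.
\<close>

lemma mixed_difference_mean_value:
  fixes f :: "'a::real_normed_vector \<Rightarrow> real"
  assumes h: "0 < h"
    and f: "\<And>s t. s \<in> {0..h} \<Longrightarrow> t \<in> {0..h} \<Longrightarrow> f differentiable at (x + s *\<^sub>R u + t *\<^sub>R v)"
    and f': "\<And>s t. s \<in> {0..h} \<Longrightarrow> t \<in> {0..h} \<Longrightarrow>
       (\<lambda>y. frechet_derivative f (at y) u) differentiable at (x + s *\<^sub>R u + t *\<^sub>R v)"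
  shows "\<exists>s\<in>{0..h}. \<exists>t\<in>{0..h}.
     f (x + h *\<^sub>R u + h *\<^sub>R v) - f (x + h *\<^sub>R u) - f (x + h *\<^sub>R v) + f x =
     h * (h * frechet_derivative (\<lambda>y. frechet_derivative f (at y) u) (at (x + s *\<^sub>R u + t *\<^sub>R v)) v)"
proof -
  let ?F = "\<lambda>y. frechet_derivative f (at y) u"
  have "((\<lambda>s. f (x + s *\<^sub>R u + h *\<^sub>R v) - f (x + s *\<^sub>R u)) has_real_derivative
      ?F (x + s *\<^sub>R u + h *\<^sub>R v) - ?F (x + s *\<^sub>R u)) (at s)" if "0 \<le> s" "s \<le> h" for s
    using has_real_derivative_along_line[of f "x + h *\<^sub>R v" s u]
      has_real_derivative_along_line[of f x s u] f[of s h] f[of s 0] h that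
    by (intro derivative_intros) (simp_all add: algebra_simps)
  from MVT2[OF h this] obtain s where s: "0 < s" "s < h" and
    1: "f (x + h *\<^sub>R u + h *\<^sub>R v) - f (x + h *\<^sub>R u) - (f (x + h *\<^sub>R v) - f x) =
      h * (?F (x + s *\<^sub>R u + h *\<^sub>R v) - ?F (x + s *\<^sub>R u))"
    by auto
  have "((\<lambda>t. ?F (x + s *\<^sub>R u + t *\<^sub>R v)) has_real_derivative
      frechet_derivative ?F (at (x + s *\<^sub>R u + t *\<^sub>R v)) v) (at t)" if "0 \<le> t" "t \<le> h" for t
    using f'[of s t] s that by (intro has_real_derivative_along_line) simp
  from MVT2[OF h this] obtain t where t: "0 < t" "t < h" and
    2: "?F (x + s *\<^sub>R u + h *\<^sub>R v) - ?F (x + s *\<^sub>R u) =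
      h * frechet_derivative ?F (at (x + s *\<^sub>R u + t *\<^sub>R v)) v"
    by auto
  show ?thesis
    using 1 2 s t by (intro bexI[of _ s] bexI[of _ t]) simp_all
qed

text \<open>
  Were the two mixed derivatives different at \<open>x\<close>, then by continuity they would stay apart on a
  ball around \<open>x\<close>. But the second difference over a small parallelogram spanned by \<open>h u\<close> and \<open>h v\<close>
  is \<open>h\<^sup>2\<close> times a value of either of them in that ball.
\<close>

lemma second_derivative_symmetric_real:
  fixes f :: "'a::real_normed_vector \<Rightarrow> real"
  assumes S: "open S" "x \<in> S" and f: "Ck_on 2 S f"
  shows "frechet_derivative (\<lambda>y. frechet_derivative f (at y) u) (at x) v =
         frechet_derivative (\<lambda>y. frechet_derivative f (at y) v) (at x) u"
proof -
  define D where "D u v y = frechet_derivative (\<lambda>y. frechet_derivative f (at y) u) (at y) v" for u v y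
  have diff: "f differentiable at y" "(\<lambda>y. frechet_derivative f (at y) u) differentiable at y"
    if "y \<in> S" for y u
    using f that by (simp_all add: numeral_2_eq_2)
  have cont: "continuous_on S (D u v)" for u v
    using f by (simp add: numeral_2_eq_2 D_def)
  have "D u v x = D v u x"
  proof (rule ccontr)
    assume ne: "D u v x \<noteq> D v u x"
    \<comment> \<open>Half the gap: values strictly within \<open>e\<close> of the two numbers cannot coincide.\<close>
    define e where "e = \<bar>D u v x - D v u x\<bar> / 2"
    have e: "e > 0" using ne by (simp add: e_def)
    have "\<forall>\<^sub>F y in nhds x. dist (D u v y) (D u v x) < e \<and> dist (D v u y) (D v u x) < e \<and> y \<in> S"
    proof (intro eventually_conj)
      have "isCont (D u v) x" for u v
        using cont S continuous_on_eq_continuous_at by blast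
      then show "\<forall>\<^sub>F y in nhds x. dist (D u v y) (D u v x) < e"
        "\<forall>\<^sub>F y in nhds x. dist (D v u y) (D v u x) < e"
        using e unfolding continuous_at_eps_delta eventually_nhds_metric by blast+
    qed (use S eventually_nhds_in_open in blast)
    then obtain d where d: "d > 0" and near: "\<And>y. dist y x < d \<Longrightarrow>
        dist (D u v y) (D u v x) < e \<and> dist (D v u y) (D v u x) < e \<and> y \<in> S"
      unfolding eventually_nhds_metric by blast
    \<comment> \<open>Keeps the parallelogram inside the ball of radius \<open>d\<close>; the summand 1 covers \<open>u = v = 0\<close>.\<close>
    define h where "h = d / (norm u + norm v + 1)"
    have pos: "norm u + norm v + 1 > 0"
      by (meson add_nonneg_pos add_nonneg_nonneg norm_ge_zero zero_less_one)
    then have h: "h > 0" using d by (simp add: h_def)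
    have small: "dist (x + s *\<^sub>R u + t *\<^sub>R v) x < d" if "s \<in> {0..h}" "t \<in> {0..h}" for s t
    proof -
      have "dist (x + s *\<^sub>R u + t *\<^sub>R v) x = norm (s *\<^sub>R u + t *\<^sub>R v)"
        by (simp add: dist_norm algebra_simps)
      also have "\<dots> \<le> s * norm u + t * norm v"
        using norm_triangle_ineq[of "s *\<^sub>R u" "t *\<^sub>R v"] that by simp
      also have "\<dots> \<le> h * norm u + h * norm v"
        using that by (intro add_mono mult_right_mono) auto
      also have "\<dots> < h * (norm u + norm v + 1)" using h by (simp add: algebra_simps)
      also have "\<dots> = d" using pos by (simp add: h_def)
      finally show ?thesis .
    qed
    have inS: "x + s *\<^sub>R u + t *\<^sub>R v \<in> S" "x + s *\<^sub>R v + t *\<^sub>R u \<in> S"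
      if "s \<in> {0..h}" "t \<in> {0..h}" for s t
      using near[OF small[of s t]] near[OF small[of t s]] that by (simp_all add: add_ac)
    obtain s t where st: "s \<in> {0..h}" "t \<in> {0..h}" and
      1: "f (x + h *\<^sub>R u + h *\<^sub>R v) - f (x + h *\<^sub>R u) - f (x + h *\<^sub>R v) + f x =
          h * (h * D u v (x + s *\<^sub>R u + t *\<^sub>R v))"
      using mixed_difference_mean_value[OF h diff(1)[OF inS(1)] diff(2)[OF inS(1)]]
      unfolding D_def by blast
    obtain s' t' where st': "s' \<in> {0..h}" "t' \<in> {0..h}" and
      2: "f (x + h *\<^sub>R v + h *\<^sub>R u) - f (x + h *\<^sub>R v) - f (x + h *\<^sub>R u) + f x =
          h * (h * D v u (x + s' *\<^sub>R v + t' *\<^sub>R u))"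
      using mixed_difference_mean_value[OF h diff(1)[OF inS(2)] diff(2)[OF inS(2)]]
      unfolding D_def by blast
    have swap: "x + h *\<^sub>R v + h *\<^sub>R u = x + h *\<^sub>R u + h *\<^sub>R v"
      "x + s' *\<^sub>R v + t' *\<^sub>R u = x + t' *\<^sub>R u + s' *\<^sub>R v" by (simp_all add: add_ac)
    from 1 2[unfolded swap] have "h * (h * D u v (x + s *\<^sub>R u + t *\<^sub>R v)) = h * (h * D v u (x + t' *\<^sub>R u + s' *\<^sub>R v))"
      by linarith
    with h have "D u v (x + s *\<^sub>R u + t *\<^sub>R v) = D v u (x + t' *\<^sub>R u + s' *\<^sub>R v)"
      by simp
    moreover have "dist (D u v (x + s *\<^sub>R u + t *\<^sub>R v)) (D u v x) < e"
      "dist (D v u (x + t' *\<^sub>R u + s' *\<^sub>R v)) (D v u x) < e"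
      using near small st st' by blast+
    ultimately show False unfolding e_def dist_real_def by argo
  qed
  then show ?thesis by (simp add: D_def)
qed

text \<open>
  The vector-valued case follows by testing against each fixed vector, since taking the inner product
  commutes with differentiation.
\<close>

lemma second_derivative_symmetric:
  fixes f :: "'a::real_normed_vector \<Rightarrow> 'b::real_inner"
  assumes S: "open S" "x \<in> S" and f: "smooth_on S f"
  shows "frechet_derivative (\<lambda>y. frechet_derivative f (at y) u) (at x) v =
         frechet_derivative (\<lambda>y. frechet_derivative f (at y) v) (at x) u"
proof (rule vector_eq_rdot[THEN iffD1], intro allI)
  fix b :: 'b
  have lin: "bounded_linear (\<lambda>z. z \<bullet> b)" by (rule bounded_linear_inner_left)
  have 1: "frechet_derivative (\<lambda>y. frechet_derivative f (at y) u) (at x) v \<bullet> b =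
    frechet_derivative (\<lambda>y. frechet_derivative (\<lambda>z. f z \<bullet> b) (at y) u) (at x) v" for u v
  proof -
    have "frechet_derivative (\<lambda>y. frechet_derivative f (at y) u \<bullet> b) (at x) =
      frechet_derivative (\<lambda>y. frechet_derivative (\<lambda>z. f z \<bullet> b) (at y) u) (at x)"
    proof (rule frechet_derivative_transform_within_open[OF _ S])
      show "(\<lambda>y. frechet_derivative f (at y) u \<bullet> b) differentiable at x"
        using frechet_derivative_bounded_linear(2)[OF lin]
          smooth_on_differentiable[OF smooth_on_frechet_derivative[OF f] S(2)] by blast
      show "frechet_derivative f (at y) u \<bullet> b = frechet_derivative (\<lambda>z. f z \<bullet> b) (at y) u"
        if "y \<in> S" for y
        using frechet_derivative_bounded_linear(1)[OF lin smooth_on_differentiable[OF f that]] by simp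
    qed
    then show ?thesis
      using frechet_derivative_bounded_linear(1)[OF lin
          smooth_on_differentiable[OF smooth_on_frechet_derivative[OF f, of u] S(2)], of v]
      by simp
  qed
  have "Ck_on 2 S (\<lambda>z. f z \<bullet> b)"
    using smooth_on_bounded_linear[OF S(1) lin f] by (simp add: smooth_on_def)
  from second_derivative_symmetric_real[OF S this]
  show "frechet_derivative (\<lambda>y. frechet_derivative f (at y) u) (at x) v \<bullet> b =
        frechet_derivative (\<lambda>y. frechet_derivative f (at y) v) (at x) u \<bullet> b"
    by (simp add: 1)
qed


section \<open>Calculus in a chart\<close>

abbreviation chart_differentiable ::
  "('a, 'n::finite) chart \<Rightarrow> ('a \<Rightarrow> 'b::real_normed_vector) \<Rightarrow> 'a \<Rightarrow> bool" where
  "chart_differentiable c f p \<equiv> in_coords c f differentiable at (snd c p)"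

abbreviation chart_smooth ::
  "('a, 'n::finite) chart \<Rightarrow> ('a \<Rightarrow> 'b::real_normed_vector) \<Rightarrow> bool" where
  "chart_smooth c f \<equiv> smooth_on (snd c ` fst c) (in_coords c f)"

lemma chart_deriv_mult:
  fixes f h :: "'a \<Rightarrow> 'b::real_normed_algebra"
  assumes c: "is_chart M c" "p \<in> fst c"
    and f: "chart_differentiable c f p" and h: "chart_differentiable c h p"
  shows "chart_deriv c a (\<lambda>q. f q * h q) p =
    chart_deriv c a f p * h p + f p * chart_deriv c a h p"
proof -
  have "(in_coords c (\<lambda>q. f q * h q) has_derivative
     (\<lambda>v. in_coords c f (snd c p) * frechet_derivative (in_coords c h) (at (snd c p)) v +
          frechet_derivative (in_coords c f) (at (snd c p)) v * in_coords c h (snd c p))) (at (snd c p))"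
    using has_derivative_mult[OF f[unfolded frechet_derivative_works] h[unfolded frechet_derivative_works]]
    by (simp add: in_coords_def o_def)
  from frechet_derivative_at[OF this, symmetric] show ?thesis
    by (simp add: chart_deriv_def in_coords_chart[OF c])
qed

lemma chart_deriv_sum:
  assumes "\<And>i. i \<in> I \<Longrightarrow> chart_differentiable c (f i) p"
  shows "chart_deriv c a (\<lambda>q. \<Sum>i\<in>I. f i q) p = (\<Sum>i\<in>I. chart_deriv c a (f i) p)"
proof -
  have "(in_coords c (\<lambda>q. \<Sum>i\<in>I. f i q) has_derivative
     (\<lambda>v. \<Sum>i\<in>I. frechet_derivative (in_coords c (f i)) (at (snd c p)) v)) (at (snd c p))"
    using has_derivative_sum[of I "\<lambda>i. in_coords c (f i)"] assms frechet_derivative_works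
    by (fastforce simp add: in_coords_def o_def)
  from frechet_derivative_at[OF this, symmetric] show ?thesis
    by (simp add: chart_deriv_def)
qed

lemma chart_deriv_of_real:
  assumes "chart_differentiable c f p"
  shows "chart_deriv c a (\<lambda>q. complex_of_real (f q)) p = of_real (chart_deriv c a f p)"
    and "chart_differentiable c (\<lambda>q. complex_of_real (f q)) p"
  using frechet_derivative_bounded_linear[OF bounded_linear_of_real assms, where 'a1=complex]
  by (simp_all add: chart_deriv_def in_coords_def o_def)

lemma chart_differentiable_mult:
  fixes f h :: "'a \<Rightarrow> 'b::real_normed_algebra"
  assumes "chart_differentiable c f p" "chart_differentiable c h p"
  shows "chart_differentiable c (\<lambda>q. f q * h q) p"
  using differentiable_mult[OF assms] by (simp add: in_coords_def o_def)

lemma chart_differentiable_cong: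
  assumes c: "is_chart M c" "p \<in> fst c" and eq: "\<And>q. q \<in> fst c \<Longrightarrow> f q = h q"
    and f: "chart_differentiable c f p"
  shows "chart_differentiable c h p"
proof (rule differentiable_cong_open[OF _ _ _ f])
  show "open (snd c ` fst c)" "snd c p \<in> snd c ` fst c" using c by (auto simp: is_chart_def)
  show "in_coords c f y = in_coords c h y" if "y \<in> snd c ` fst c" for y
    using that eq by (auto simp: in_coords_chart[OF c(1)])
qed

lemma chart_smooth_differentiable:
  "chart_smooth c f \<Longrightarrow> p \<in> fst c \<Longrightarrow> chart_differentiable c f p"
  using smooth_on_differentiable by blast

lemma chart_smooth_bounded_linear:
  assumes "is_chart M c" "bounded_linear h" "chart_smooth c f"
  shows "chart_smooth c (\<lambda>q. h (f q))"
  using smooth_on_bounded_linear[OF _ assms(2,3)] assms(1)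
  by (simp add: in_coords_def o_def is_chart_def)

text \<open>
  In coordinates, \<open>chart_deriv\<close> is a directional derivative only on the image of the chart domain; this
  suffices, because that image is open and differentiation is local.
\<close>

lemma in_coords_chart_deriv:
  assumes "is_chart M c" "x \<in> snd c ` fst c"
  shows "in_coords c (chart_deriv c a f) x = frechet_derivative (in_coords c f) (at x) (axis a 1)"
  using assms by (auto simp: in_coords_chart chart_deriv_def)

lemma chart_differentiable_chart_deriv:
  assumes c: "is_chart M c" "p \<in> fst c" and f: "chart_smooth c f"
  shows "chart_differentiable c (chart_deriv c a f) p"
proof (rule differentiable_cong_open)
  show "open (snd c ` fst c)" "snd c p \<in> snd c ` fst c" using c by (auto simp: is_chart_def)
  then show "(\<lambda>x. frechet_derivative (in_coords c f) (at x) (axis a 1)) differentiable at (snd c p)"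
    using smooth_on_frechet_derivative[OF f] smooth_on_differentiable by blast
qed (simp add: in_coords_chart_deriv[OF c(1)])

lemma chart_deriv_commute:
  fixes f :: "'a \<Rightarrow> 'b::real_inner"
  assumes c: "is_chart M c" "p \<in> fst c" and f: "chart_smooth c f"
  shows "chart_deriv c a (chart_deriv c b f) p = chart_deriv c b (chart_deriv c a f) p"
proof -
  have o: "open (snd c ` fst c)" "snd c p \<in> snd c ` fst c" using c by (auto simp: is_chart_def)
  have "chart_deriv c a (chart_deriv c b f) p =
    frechet_derivative (\<lambda>x. frechet_derivative (in_coords c f) (at x) (axis b 1)) (at (snd c p)) (axis a 1)"
    for a b
    using frechet_derivative_transform_within_open
      [OF chart_differentiable_chart_deriv[OF c f] o in_coords_chart_deriv[OF c(1)]]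
    by (simp add: chart_deriv_def[of c a "chart_deriv c b f"])
  then show ?thesis using second_derivative_symmetric[OF o f] by simp
qed


section \<open>Differentiability of the Christoffel symbols\<close>

lemma differentiable_prod:
  fixes f :: "'i \<Rightarrow> 'a::real_normed_vector \<Rightarrow> 'b::real_normed_field"
  assumes "\<And>i. i \<in> I \<Longrightarrow> f i differentiable at x"
  shows "(\<lambda>y. \<Prod>i\<in>I. f i y) differentiable at x"
proof (rule differentiableI)
  show "((\<lambda>y. \<Prod>i\<in>I. f i y) has_derivative
      (\<lambda>v. \<Sum>i\<in>I. frechet_derivative (f i) (at x) v * (\<Prod>j\<in>I - {i}. f j x))) (at x)"
    by (rule has_derivative_prod) (rule assms[unfolded frechet_derivative_works])
qed

lemma differentiable_det:
  fixes G :: "'a::real_normed_vector \<Rightarrow> real ^ 'n ^ 'n"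
  assumes "\<And>i j. (\<lambda>y. G y $ i $ j) differentiable at x"
  shows "(\<lambda>y. det (G y)) differentiable at x"
  unfolding det_def
  by (intro differentiable_sum differentiable_mult differentiable_prod differentiable_const ballI assms)
     (simp add: finite_permutations)

text \<open>
  The column \<open>b\<close> of the inverse solves the linear system with right-hand side the basis vector \<open>b\<close>, so
  Cramer's rule writes the inverse in terms of determinants, which are polynomial in the entries.
\<close>

lemma matrix_inv_cramer:
  fixes G :: "real ^ 'n ^ 'n"
  assumes "invertible G"
  shows "matrix_inv G $ a $ b =
    det (\<chi> i j. if j = a then axis b 1 $ i else G $ i $ j) / det G"
proof -
  have "G ** matrix_inv G = mat 1"
    using assms by (auto simp: matrix_inv_def invertible_def intro: someI2_ex)
  then have "G *v (matrix_inv G *v axis b 1) = axis b 1"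
    by (simp add: matrix_vector_mul_assoc)
  then have "matrix_inv G *v axis b 1 =
      (\<chi> k. det (\<chi> i j. if j = k then axis b 1 $ i else G $ i $ j) / det G)"
    using cramer[of G] assms invertible_det_nz by blast
  then have "(matrix_inv G *v axis b 1) $ a =
      det (\<chi> i j. if j = a then axis b 1 $ i else G $ i $ j) / det G"
    by simp
  then show ?thesis by (simp add: matrix_vector_mul_component inner_axis)
qed

lemma differentiable_matrix_inv:
  fixes G :: "'a::real_normed_vector \<Rightarrow> real ^ 'n ^ 'n"
  assumes S: "open S" "x \<in> S" and inv: "\<And>y. y \<in> S \<Longrightarrow> invertible (G y)"
    and G: "\<And>i j. (\<lambda>y. G y $ i $ j) differentiable at x"
  shows "(\<lambda>y. matrix_inv (G y) $ a $ b) differentiable at x"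
proof (rule differentiable_cong_open[OF S])
  show "(\<lambda>y. det (\<chi> i j. if j = a then axis b 1 $ i else G y $ i $ j) / det (G y)) differentiable at x"
  proof (intro differentiable_divide differentiable_det)
    show "(\<lambda>y. (\<chi> i j. if j = a then axis b 1 $ i else G y $ i $ j) $ i $ j) differentiable at x"
      for i j using G by (cases "j = a") simp_all
    show "det (G x) \<noteq> 0" using inv[OF S(2)] invertible_det_nz by blast
  qed (rule G)
qed (simp add: inv matrix_inv_cramer)

lemma chart_smooth_metric_component:
  fixes g :: "('a, 'n::finite, real ^ 'n ^ 'n) field"
  assumes g: "pseudo_riemannian_metric \<A> r g" and c: "is_chart M c" "c \<in> \<A>"
  shows "chart_smooth c (\<lambda>q. g c q $ a $ b)"
proof (rule chart_smooth_bounded_linear[OF c(1), where h = "\<lambda>z. z $ a $ b"])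
  show "bounded_linear (\<lambda>z :: real ^ 'n ^ 'n. z $ a $ b)"
    by (intro bounded_linear_compose[OF bounded_linear_vec_nth bounded_linear_vec_nth])
  show "chart_smooth c (g c)" using g c(2) by (simp add: pseudo_riemannian_metric_def)
qed

lemma chart_differentiable_christoffel:
  fixes g :: "('a, 'n::finite, real ^ 'n ^ 'n) field"
  assumes g: "pseudo_riemannian_metric \<A> r g" and c: "is_chart M c" "c \<in> \<A>" "p \<in> fst c"
  shows "chart_differentiable c (\<lambda>q. christoffel g c q a b e) p"
proof -
  note gsm = chart_smooth_metric_component[OF g c(1,2)]
  have D: "chart_differentiable c (\<lambda>q. chart_deriv c i (\<lambda>q. g c q $ j $ k) q) p" for i j k
    using chart_differentiable_chart_deriv[OF c(1,3) gsm] .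
  have "(\<lambda>y. matrix_inv (in_coords c (g c) y) $ i $ j) differentiable at (snd c p)" for i j
  proof (rule differentiable_matrix_inv)
    show "open (snd c ` fst c)" "snd c p \<in> snd c ` fst c" using c by (auto simp: is_chart_def)
    show "invertible (in_coords c (g c) y)" if "y \<in> snd c ` fst c" for y
      using that metric_invertible[OF g c(2)] by (auto simp: in_coords_chart[OF c(1)])
    show "(\<lambda>y. in_coords c (g c) y $ i $ j) differentiable at (snd c p)" for i j
      using chart_smooth_differentiable[OF gsm c(3)] by (simp add: in_coords_def o_def)
  qed
  with D show ?thesis
    unfolding christoffel_def in_coords_def o_def
    by (intro differentiable_divide differentiable_sum differentiable_mult differentiable_add
        differentiable_diff differentiable_const ballI) simp_all
qed


section \<open>Parallel forms and curvature\<close>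

lemma chart_smooth_one_form_component:
  assumes "complex_one_form \<A> \<omega>" "is_chart M c" "c \<in> \<A>"
  shows "chart_smooth c (\<lambda>q. \<omega> c q $ a)"
proof (rule chart_smooth_bounded_linear[OF assms(2) bounded_linear_vec_nth])
  show "chart_smooth c (\<omega> c)" using assms unfolding complex_one_form_def by blast
qed

text \<open>
  The right-hand side is \<open>A\<^sub>I\<^sub>h \<Gamma>\<^sup>h\<^sub>b\<^sub>e\<close>, so the conclusion reads \<open>\<nabla>A\<^sub>I = 0\<close>. The proof is the argument that
  makes the Levi-Civita connection unique: symmetry in one pair of indices together with antisymmetry
  in an overlapping pair forces a three-index array to vanish.
\<close>

lemma closed_coframe_parallel:
  fixes A :: "'i::finite \<Rightarrow> ('a, 'n::finite, complex ^ 'n) field"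
  assumes g: "pseudo_riemannian_metric \<A> r g" and c: "is_chart M c" "c \<in> \<A>" "p \<in> fst c"
    and A: "\<And>I. complex_one_form \<A> (A I)" and ind: "pointwise_independent \<A> A"
    and gA: "\<And>q a b. q \<in> fst c \<Longrightarrow>
      complex_of_real (g c q $ a $ b) = (\<Sum>I\<in>UNIV. A I c q $ a * A I c q $ b)"
    and closed: "\<And>I. closed_one_form \<A> (A I)"
  shows "chart_deriv c b (\<lambda>q. A I c q $ e) p =
    (\<Sum>h\<in>UNIV. A I c p $ h * of_real (christoffel g c p h b e))"
proof -
  define \<Gamma> where "\<Gamma> = christoffel g c p"
  define d where "d I b e = chart_deriv c b (\<lambda>q. A I c q $ e) p" for I b e
  \<comment> \<open>\<open>X I b e\<close> is the covariant derivative \<open>(\<nabla>\<^sub>b A\<^sub>I)\<^sub>e\<close>, and \<open>Y\<close> its contraction with the coframe.\<close>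
  define X where "X I b e = d I b e - (\<Sum>h\<in>UNIV. A I c p $ h * of_real (\<Gamma> h b e))" for I b e
  define Y where "Y f b e = (\<Sum>I\<in>UNIV. X I b e * A I c p $ f)" for f b e
  have torsion: "\<Gamma> a b e = \<Gamma> a e b"
    and compat: "chart_deriv c e (\<lambda>q. g c q $ a $ b) p =
        (\<Sum>h\<in>UNIV. \<Gamma> h e a * g c p $ h $ b + \<Gamma> h e b * g c p $ a $ h)" for a b e
    using christoffel_levi_civita[OF g c, of \<Gamma>] unfolding \<Gamma>_def by blast+
  have dA: "d I b e = d I e b" for I b e
  proof -
    have "ext_deriv (A I) c p $ b $ e = 0" using closed[of I] c by (simp add: closed_one_form_def)
    then show ?thesis by (simp add: ext_deriv_def d_def)
  qed
  have Xsym: "X I b e = X I e b" for I b e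
    unfolding X_def dA[of I b e] by (subst torsion) (rule refl)
  have Ad: "chart_differentiable c (\<lambda>q. A I c q $ a) p" for I a
    using chart_smooth_differentiable[OF chart_smooth_one_form_component[OF A c(1,2)] c(3)] .
  have dg: "complex_of_real (chart_deriv c e (\<lambda>q. g c q $ a $ b) p) =
      (\<Sum>I\<in>UNIV. d I e a * A I c p $ b + A I c p $ a * d I e b)" for a b e
  proof -
    have "complex_of_real (chart_deriv c e (\<lambda>q. g c q $ a $ b) p) =
        chart_deriv c e (\<lambda>q. complex_of_real (g c q $ a $ b)) p"
      using chart_deriv_of_real(1)[OF chart_smooth_differentiable
          [OF chart_smooth_metric_component[OF g c(1,2)] c(3)]] by simp
    also have "\<dots> = chart_deriv c e (\<lambda>q. \<Sum>I\<in>UNIV. A I c q $ a * A I c q $ b) p"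
      by (rule chart_deriv_cong[OF c(1,3) gA])
    also have "\<dots> = (\<Sum>I\<in>UNIV. d I e a * A I c p $ b + A I c p $ a * d I e b)"
      using Ad by (simp add: chart_deriv_sum chart_differentiable_mult chart_deriv_mult[OF c(1,3)] d_def)
    finally show ?thesis .
  qed
  have g\<Gamma>: "complex_of_real (\<Sum>h\<in>UNIV. \<Gamma> h e a * g c p $ h $ b) =
      (\<Sum>I\<in>UNIV. (\<Sum>h\<in>UNIV. A I c p $ h * of_real (\<Gamma> h e a)) * A I c p $ b)" for a b e
  proof -
    have "complex_of_real (\<Sum>h\<in>UNIV. \<Gamma> h e a * g c p $ h $ b) =
        (\<Sum>h\<in>UNIV. \<Sum>I\<in>UNIV. A I c p $ h * of_real (\<Gamma> h e a) * A I c p $ b)"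
      by (simp add: gA[OF c(3)] sum_distrib_left mult_ac)
    also have "\<dots> = (\<Sum>I\<in>UNIV. \<Sum>h\<in>UNIV. A I c p $ h * of_real (\<Gamma> h e a) * A I c p $ b)"
      by (rule sum.swap)
    finally show ?thesis by (simp add: sum_distrib_right)
  qed
  have gsym: "g c p $ a $ h = g c p $ h $ a" for a h
  proof -
    have "complex_of_real (g c p $ a $ h) = of_real (g c p $ h $ a)"
      by (simp add: gA[OF c(3)] mult.commute)
    then show ?thesis by simp
  qed
  \<comment> \<open>In \<open>Y\<close>, \<open>P\<close> collects the partial derivatives of the forms and \<open>G\<close> the connection terms;
    symmetrized, they give the two sides of the identity \<open>\<nabla>g = 0\<close>.\<close>
  define P where "P e a b = (\<Sum>I\<in>UNIV. d I e a * A I c p $ b)" for e a b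
  define G where "G e a b =
    (\<Sum>I\<in>UNIV. (\<Sum>h\<in>UNIV. A I c p $ h * of_real (\<Gamma> h e a)) * A I c p $ b)" for e a b
  have Y_split: "Y b e a = P e a b - G e a b" for a b e
    by (simp add: Y_def X_def P_def G_def left_diff_distrib sum_subtractf)
  have Yanti: "Y b e a + Y a e b = 0" for a b e
  proof -
    have "chart_deriv c e (\<lambda>q. g c q $ a $ b) p =
        (\<Sum>h\<in>UNIV. \<Gamma> h e a * g c p $ h $ b) + (\<Sum>h\<in>UNIV. \<Gamma> h e b * g c p $ h $ a)"
      by (subst compat) (simp add: sum.distrib gsym[of a])
    then have "complex_of_real (chart_deriv c e (\<lambda>q. g c q $ a $ b) p) = G e a b + G e b a"
      by (simp only: of_real_add g\<Gamma> G_def)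
    moreover have "complex_of_real (chart_deriv c e (\<lambda>q. g c q $ a $ b) p) = P e a b + P e b a"
      unfolding dg P_def by (simp add: sum.distrib mult.commute)
    ultimately have "P e a b + P e b a - (G e a b + G e b a) = 0"
      by simp
    then show ?thesis
      by (simp only: Y_split add_diff_add)
  qed
  have Ysym: "Y f b e = Y f e b" for f b e
    unfolding Y_def by (subst Xsym) (rule refl)
  have Y0: "Y f b e = 0" for f b e
  proof -
    have neg: "Y b e a = - Y a e b" for a b e
      using Yanti[of b e a] by (simp add: eq_neg_iff_add_eq_0)
    \<comment> \<open>The product of the transpositions (1 3) and (2 3) is a 3-cycle, so alternating them three times
      each returns to the original index order, with three changes of sign.\<close>
    have "Y f b e = - Y e b f" by (rule neg)
    also have "\<dots> = - Y e f b" by (subst Ysym) (rule refl)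
    also have "\<dots> = Y b f e" by (subst neg) simp
    also have "\<dots> = Y b e f" by (rule Ysym)
    also have "\<dots> = - Y f e b" by (rule neg)
    also have "\<dots> = - Y f b e" by (subst Ysym) (rule refl)
    finally have "Y f b e = - Y f b e" .
    then show ?thesis by simp
  qed
  have "(\<Sum>I\<in>UNIV. X I b e *s A I c p) = 0"
    using Y0[of _ b e] by (simp add: vec_eq_iff Y_def)
  then have "X I b e = 0"
    using ind[unfolded pointwise_independent_def, rule_format, OF c(2,3), of "\<lambda>I. X I b e"] by blast
  then show ?thesis by (simp add: X_def d_def \<Gamma>_def)
qed

text \<open>
  The Ricci identity for a parallel form. The equation \<open>\<nabla>\<omega> = 0\<close> is assumed on the whole chart domain,
  because it gets differentiated.
\<close>

lemma parallel_form_annihilates_curvature: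
  fixes \<omega> :: "('a, 'n::finite, complex ^ 'n) field"
  assumes g: "pseudo_riemannian_metric \<A> r g" and c: "is_chart M c" "c \<in> \<A>" "p \<in> fst c"
    and \<omega>: "complex_one_form \<A> \<omega>"
    and parallel: "\<And>q b e. q \<in> fst c \<Longrightarrow> chart_deriv c b (\<lambda>q. \<omega> c q $ e) q =
      (\<Sum>h\<in>UNIV. \<omega> c q $ h * of_real (christoffel g c q h b e))"
  shows "(\<Sum>h\<in>UNIV. \<omega> c p $ h * of_real (riemann_up g c p h b e f)) = 0"
proof -
  define \<Gamma> where "\<Gamma> = christoffel g c p"
  define d\<Gamma> where "d\<Gamma> k h b e = chart_deriv c k (\<lambda>q. christoffel g c q h b e) p" for k h b e
  let ?w = "\<lambda>h. \<omega> c p $ h"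
  have wd: "chart_differentiable c (\<lambda>q. \<omega> c q $ h) p" for h
    using chart_smooth_differentiable[OF chart_smooth_one_form_component[OF \<omega> c(1,2)] c(3)] .
  have \<Gamma>d: "chart_differentiable c (\<lambda>q. christoffel g c q h b e) p" for h b e
    by (rule chart_differentiable_christoffel[OF g c])
  \<comment> \<open>Differentiate \<open>\<partial>\<^sub>f \<omega>\<^sub>b = \<omega>\<^sub>k \<Gamma>\<^sup>k\<^sub>f\<^sub>b\<close> and eliminate \<open>\<partial>\<^sub>e \<omega>\<^sub>k\<close> by the same equation.\<close>
  have second: "chart_deriv c e (chart_deriv c f (\<lambda>q. \<omega> c q $ b)) p =
      (\<Sum>h\<in>UNIV. \<Sum>k\<in>UNIV. ?w h * of_real (\<Gamma> h e k * \<Gamma> k f b))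
      + (\<Sum>h\<in>UNIV. ?w h * of_real (d\<Gamma> e h f b))" for e f
  proof -
    have "chart_deriv c e (chart_deriv c f (\<lambda>q. \<omega> c q $ b)) p =
        chart_deriv c e (\<lambda>q. \<Sum>h\<in>UNIV. \<omega> c q $ h * of_real (christoffel g c q h f b)) p"
      by (rule chart_deriv_cong[OF c(1,3) parallel])
    also have "\<dots> = (\<Sum>k\<in>UNIV. (\<Sum>h\<in>UNIV. ?w h * of_real (\<Gamma> h e k)) * of_real (\<Gamma> k f b)
        + ?w k * of_real (d\<Gamma> e k f b))"
      using wd \<Gamma>d
      by (simp add: chart_deriv_sum chart_differentiable_mult chart_deriv_mult[OF c(1,3)]
          chart_deriv_of_real parallel[OF c(3)] \<Gamma>_def d\<Gamma>_def)
    also have "\<dots> = (\<Sum>k\<in>UNIV. \<Sum>h\<in>UNIV. ?w h * of_real (\<Gamma> h e k * \<Gamma> k f b))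
        + (\<Sum>k\<in>UNIV. ?w k * of_real (d\<Gamma> e k f b))"
      by (simp add: sum.distrib sum_distrib_right mult.assoc)
    also have "(\<Sum>k\<in>UNIV. \<Sum>h\<in>UNIV. ?w h * of_real (\<Gamma> h e k * \<Gamma> k f b)) =
        (\<Sum>h\<in>UNIV. \<Sum>k\<in>UNIV. ?w h * complex_of_real (\<Gamma> h e k * \<Gamma> k f b))"
      by (rule sum.swap)
    finally show ?thesis .
  qed
  have "(\<Sum>h\<in>UNIV. ?w h * of_real (riemann_up g c p h b e f)) =
      chart_deriv c e (chart_deriv c f (\<lambda>q. \<omega> c q $ b)) p
      - chart_deriv c f (chart_deriv c e (\<lambda>q. \<omega> c q $ b)) p"
    unfolding second
    by (simp add: riemann_up_def flip: \<Gamma>_def d\<Gamma>_def)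
      (simp add: ring_distribs sum.distrib sum_subtractf sum_distrib_left)
  also have "\<dots> = 0"
    using chart_deriv_commute[OF c(1,3) chart_smooth_one_form_component[OF \<omega> c(1,2)]] by simp
  finally show ?thesis .
qed

theorem theorem3:
  fixes M :: "'a topology"
    and \<A> :: "('a, 'n::finite) chart set"
    and g :: "('a, 'n, real ^ 'n ^ 'n) field"
    and A :: "'n \<Rightarrow> ('a, 'n, complex ^ 'n) field"
    and r :: nat
  assumes "compact_oriented_connected_manifold M \<A>"
    and "pseudo_riemannian_metric \<A> r g"
    and "\<And>I. complex_one_form \<A> (A I)"
    and "pointwise_independent \<A> A"
    and "\<And>c p a b. c \<in> \<A> \<Longrightarrow> p \<in> fst c \<Longrightarrow>
           complex_of_real (g c p $ a $ b) = (\<Sum>I\<in>UNIV. A I c p $ a * A I c p $ b)"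
    and "\<And>I. closed_one_form \<A> (A I)"
  shows "\<forall>c\<in>\<A>. \<forall>p\<in>fst c. \<forall>a b e f. riemann g c p a b e f = 0"
proof (intro ballI allI)
  fix c p a b e f
  assume c: "c \<in> \<A>" and p: "p \<in> fst c"
  have chart: "is_chart M c"
    using assms(1) c by (simp add: compact_oriented_connected_manifold_def smooth_atlas_def)
  have R: "(\<Sum>h\<in>UNIV. A I c p $ h * of_real (riemann_up g c p h b e f)) = 0" for I
  proof (rule parallel_form_annihilates_curvature[OF assms(2) chart c p assms(3)])
    show "chart_deriv c b (\<lambda>q. A I c q $ e) q =
      (\<Sum>h\<in>UNIV. A I c q $ h * of_real (christoffel g c q h b e))" if "q \<in> fst c" for q b e
      by (rule closed_coframe_parallel[OF assms(2) chart c that assms(3,4) assms(5)[OF c] assms(6)])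
  qed
  have "complex_of_real (riemann g c p a b e f) =
      (\<Sum>h\<in>UNIV. \<Sum>I\<in>UNIV. A I c p $ a * (A I c p $ h * of_real (riemann_up g c p h b e f)))"
    by (simp add: riemann_def assms(5)[OF c p] sum_distrib_right mult.assoc)
  also have "\<dots> = (\<Sum>I\<in>UNIV. A I c p $ a * (\<Sum>h\<in>UNIV. A I c p $ h * of_real (riemann_up g c p h b e f)))"
    by (subst sum.swap) (simp add: sum_distrib_left)
  also have "\<dots> = 0" by (simp add: R)
  finally show "riemann g c p a b e f = 0" by simp
qed

end
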